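(* Let $\mathbb{E}_1,\mathbb{E}_2$ be Euclidean spaces, let $X\subset\mathbb{E}_1$ be a nonempty, convex set, let $K,L\subset\mathbb{E}_2$ be nonempty, closed, convex cones, let $F:\mathbb{E}_1\to\mathbb{E}_2^\bullet$ be $K$-convex, let $G:\mathbb{E}_1\to\mathbb{E}_2^\bullet$ be $L$-convex, let $f\in\Gamma(\mathbb{E}_1)$, and let $g\in\Gamma(\mathbb{E}_2)$ satisfy $g(F(x))\le g(y)$ for all $(x,y)\in K\text{-}\mathrm{epi}\,F$. Suppose there exists $$\bar x\in\mathrm{ri}\,X\cap\mathrm{ri}(\mathrm{dom}\,f)\cap\mathrm{ri}(\mathrm{dom}\,F)\cap\mathrm{ri}(\mathrm{dom}\,G)\quad\text{with}\quad F(\bar x)\in\mathrm{ri}(\mathrm{dom}\,g-K)\ \text{ and }\ G(\bar x)\in\mathrm{ri}(-L).$$ Then the following are equivalent: (a) For all $x\in X$ with $G(x)\in -L$ one has $f(x)+g(F(x))\ge 0$. (b) There exist $\bar y,\bar z,\bar s\in\mathbb{E}_1$, $\bar u\in -K^\circ$, $\bar v\in -L^\circ$ such that $$g^*(\bar u)+\langle\bar u,F\rangle^*(\bar y)+\langle\bar v,G\rangle^*(\bar z)+\sigma_X(\bar s)+f^*(-\bar y-\bar z-\bar s)\le 0.$$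
   Context: A Euclidean space is a finite-dimensional real inner product space. A cone is a set $K$ with $\lambda x\in K$ for all $\lambda\ge0$, $x\in K$; its polar is $K^\circ=\{v : \langle v,x\rangle\le 0\ \forall x\in K\}$. $\mathbb{E}_2^\bullet=\mathbb{E}_2\cup\{+\infty_\bullet\}$, where $+\infty_\bullet$ is an adjoined largest element. For $F:\mathbb{E}_1\to\mathbb{E}_2^\bullet$: $\mathrm{dom}\,F=\{x : F(x)\in\mathbb{E}_2\}$, $K\text{-}\mathrm{epi}\,F=\{(x,v)\in\mathbb{E}_1\times\mathbb{E}_2 : x\in\mathrm{dom}\,F,\ v-F(x)\in K\}$, and $F$ is $K$-convex if this set is convex. $g(F(x)):=+\infty$ if $x\notin\mathrm{dom}\,F$; $\langle v,F\rangle(x)=\langle v,F(x)\rangle$ if $x\in\mathrm{dom}\,F$ and $+\infty$ otherwise (also for $v=0$). $\Gamma(\mathbb{E})$ is the set of proper convex functions $\mathbb{E}\to\mathbb{R}\cup\{+\infty\}$. $f^*(y)=\sup_x\{\langle y,x\rangle-f(x)\}$ is the Fenchel conjugate, $\sigma_X(s)=\sup_{x\in X}\langle x,s\rangle$ the support function, $\mathrm{ri}$ the relative interior. *)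

theory Defs
  imports "HOL-Analysis.Analysis"
begin

(* Functions E -> R \<union> {+\<infinity>} are ereal-valued; the value -\<infinity> is excluded by proper_convex.
   Functions E1 -> E2 \<union> {+\<infinity>\<^sub>\<bullet>} are option-valued with None as +\<infinity>\<^sub>\<bullet>, so that dom F is
   the library's Map.dom. *)

definition polar :: "'a::euclidean_space set \<Rightarrow> 'a set"
  where "polar K = {v. \<forall>x\<in>K. v \<bullet> x \<le> 0}"

definition cone_epi :: "'b::euclidean_space set \<Rightarrow> ('a::euclidean_space \<Rightarrow> 'b option) \<Rightarrow> ('a \<times> 'b) set"
  where "cone_epi K F = {(x, v). \<exists>w. F x = Some w \<and> v - w \<in> K}"

definition cone_convex :: "'b::euclidean_space set \<Rightarrow> ('a::euclidean_space \<Rightarrow> 'b option) \<Rightarrow> bool"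
  where "cone_convex K F \<longleftrightarrow> convex (cone_epi K F)"

definition comp_top :: "('b \<Rightarrow> ereal) \<Rightarrow> ('a \<Rightarrow> 'b option) \<Rightarrow> 'a \<Rightarrow> ereal"
  where "comp_top g F x = (case F x of None \<Rightarrow> \<infinity> | Some w \<Rightarrow> g w)"

definition scalarization :: "'b::euclidean_space \<Rightarrow> ('a \<Rightarrow> 'b option) \<Rightarrow> 'a \<Rightarrow> ereal"
  where "scalarization v F = comp_top (\<lambda>w. ereal (v \<bullet> w)) F"

definition edom :: "('a \<Rightarrow> ereal) \<Rightarrow> 'a set"
  where "edom f = {x. f x < \<infinity>}"

definition proper_convex :: "('a::euclidean_space \<Rightarrow> ereal) \<Rightarrow> bool"
  where "proper_convex f \<longleftrightarrow>
    (\<forall>x. f x \<noteq> -\<infinity>) \<and> edom f \<noteq> {} \<and> convex {(x, r::real). f x \<le> ereal r}"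

definition conjugate :: "('a::euclidean_space \<Rightarrow> ereal) \<Rightarrow> 'a \<Rightarrow> ereal"
  where "conjugate f y = (SUP x. ereal (y \<bullet> x) - f x)"

definition support_fun :: "'a::euclidean_space set \<Rightarrow> 'a \<Rightarrow> ereal"
  where "support_fun X s = (SUP x\<in>X. ereal (x \<bullet> s))"

end

theory Submission
  imports Defs
begin

text \<open>
  Both (a) and the constraint qualification concern the convex set of points
  \<open>(x\<^sub>1 - x\<^sub>2, x\<^sub>1 - x\<^sub>3, x\<^sub>1 - x\<^sub>4, y\<^sub>1 - y\<^sub>2, w, r)\<close> where \<open>r\<close> is at least \<open>f x\<^sub>1 + g y\<^sub>1\<close>,
  \<open>(x\<^sub>2, y\<^sub>2)\<close> lies in the \<open>K\<close>-epigraph of \<open>F\<close>, \<open>(x\<^sub>3, w)\<close> in the \<open>L\<close>-epigraph of \<open>G\<close> and \<open>x\<^sub>4\<close>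
  in \<open>X\<close>: (a) says that \<open>r \<ge> 0\<close> at the points whose other entries vanish, and the regularity of
  the reference point says that \<open>0\<close> is relatively interior to the projection forgetting \<open>r\<close>.
  A hyperplane separating this set properly from the half line \<open>r < 0\<close> is then not vertical,
  and its slope contains the multipliers of (b), because the five groups of variables are
  independent of each other. The converse is the Fenchel-Young inequality.
\<close>

section \<open>Separation in a product with the real line, and of real inequalities\<close>

text \<open>Think of \<open>S\<close> as lying above a convex value function of \<open>e\<close>
  that is nonnegative at 0; \<open>q\<close> is a linear minorant of it. A vertical hyperplane would
  be nonnegative on the projection and zero at its relatively interior point 0, hence zero on all of
  it.\<close>

lemma nonvertical_support:
  fixes S :: "('n::euclidean_space \<times> real) set"
  assumes S: "convex S" and ri: "0 \<in> rel_interior (fst ` S)"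
    and nonneg: "\<And>r. (0, r) \<in> S \<Longrightarrow> 0 \<le> r"
  obtains q where "\<And>e r. (e, r) \<in> S \<Longrightarrow> q \<bullet> e \<le> r"
proof -
  \<comment> \<open>Raising \<open>S\<close> strictly puts 0 in \<open>T\<close> only if some
    \<open>(0, r)\<close> in \<open>S\<close> has r < 0, so separating \<open>S\<close> from the
    half line r < 0 becomes separating \<open>T\<close> from the single point 0.\<close>
  define T where "T = (\<lambda>(p, t). p + (0, t)) ` (S \<times> {0::real<..})"
  have T_I: "(e, r + t) \<in> T" if "(e, r) \<in> S" "t > 0" for e r t
    unfolding T_def using that by (force simp: image_iff)
  have T_E: "\<exists>r t. (e, r) \<in> S \<and> t > 0 \<and> s = r + t" if "(e, s) \<in> T" for e s
    using that unfolding T_def by auto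
  have "linear (\<lambda>(p::'n \<times> real, t::real). p + (0, t))"
    by (rule linearI) (auto simp: algebra_simps)
  then have "convex T"
    unfolding T_def by (intro convex_linear_image convex_Times S) auto
  have "0 \<in> fst ` S"
    using ri rel_interior_subset by blast
  then obtain r0 where r0: "(0, r0) \<in> S"
    by auto
  then have "T \<noteq> {}"
    using T_I[of 0 r0 1] by auto
  have "0 \<notin> T"
    using T_E nonneg by (fastforce simp: zero_prod_def)
  \<comment> \<open>A normal inside \<open>span T\<close> makes the separation proper, which rules out a vertical hyperplane.\<close>
  obtain a where a: "a \<in> span T" "a \<noteq> 0" "\<And>x. x \<in> T \<Longrightarrow> 0 \<le> a \<bullet> x"
    using separating_hyperplane_set_0_inspan[OF \<open>convex T\<close> \<open>T \<noteq> {}\<close> \<open>0 \<notin> T\<close>] by blast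
  obtain p b where ab: "a = (p, b)"
    by (cases a)
  have sep: "0 \<le> p \<bullet> e + b * (r + t)" if "(e, r) \<in> S" "t > 0" for e r t
    using a(3)[OF T_I[OF that]] by (simp add: ab)
  have "b > 0"
  proof (rule ccontr)
    assume "\<not> b > 0"
    moreover have "b \<ge> 0"
    proof (rule ccontr)
      assume "\<not> b \<ge> 0"
      then have "b < 0" by simp
      \<comment> \<open>The shift makes \<open>r0 + t\<close> positive while \<open>e = 0\<close>
        removes the term in \<open>p\<close>, so the sign of \<open>b\<close> is exposed.\<close>
      have "0 \<le> b * (r0 + (\<bar>r0\<bar> + 1))"
        using sep[OF r0, of "\<bar>r0\<bar> + 1"] by simp
      moreover have "b * (r0 + (\<bar>r0\<bar> + 1)) < 0"
        using \<open>b < 0\<close> by (intro mult_neg_pos) auto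
      ultimately show False by simp
    qed
    ultimately have b: "b = 0" by simp
    have pos: "0 \<le> p \<bullet> e" if "e \<in> fst ` S" for e
      using that sep[of e _ 1] b by auto
    have zero: "p \<bullet> e = 0" if e: "e \<in> fst ` S" for e
    proof -
      have "convex (fst ` S)"
        by (intro convex_linear_image linear_fst S)
      \<comment> \<open>The segment from \<open>e\<close> to 0 extends beyond 0 inside the
        projection; its end is a negative multiple of \<open>e\<close>, where \<open>p\<close> is
        nonnegative as well.\<close>
      then obtain c where c: "c > 1" "(1 - c) *\<^sub>R e + c *\<^sub>R 0 \<in> fst ` S"
        using ri e convex_rel_interior_iff[of "fst ` S" 0] by blast
      then have "0 \<le> (1 - c) * (p \<bullet> e)"
        using pos[OF c(2)] by simp
      then show ?thesis
        using pos[OF e] c(1) by (smt (verit) mult_neg_pos)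
    qed
    have "a \<bullet> x = 0" if "x \<in> T" for x
    proof -
      obtain e s where x: "x = (e, s)"
        by (cases x)
      show ?thesis
        using T_E[of e s] that zero[of e] by (force simp: x ab b)
    qed
    then have "orthogonal a a"
      by (intro orthogonal_to_span[OF a(1)]) (simp add: orthogonal_def)
    with a(2) show False
      by (simp add: orthogonal_def)
  qed
  show thesis
  proof
    fix e r
    assume er: "(e, r) \<in> S"
    \<comment> \<open>\<open>sep\<close> covers only t > 0, so the bound is obtained up to every
      positive error first.\<close>
    have "- (p \<bullet> e) / b \<le> r + t" if "t > 0" for t
      using sep[OF er that] \<open>b > 0\<close> by (simp add: field_simps)
    then have "- (p \<bullet> e) / b \<le> r"
      by (rule field_le_epsilon)
    then show "(- p /\<^sub>R b) \<bullet> e \<le> r"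
      using \<open>b > 0\<close> by (simp add: divide_inverse mult.commute)
  qed
qed

text \<open>The supremum of \<open>a\<close> over \<open>A\<close> serves as \<open>c\<close>; any
  single element of \<open>B\<close> shows that it is finite.\<close>

lemma real_cut:
  fixes a b :: "_ \<Rightarrow> real"
  assumes "A \<noteq> {}" "B \<noteq> {}" and "\<And>x y. x \<in> A \<Longrightarrow> y \<in> B \<Longrightarrow> a x + b y \<le> 0"
  obtains c where "\<And>x. x \<in> A \<Longrightarrow> a x \<le> c" "\<And>y. y \<in> B \<Longrightarrow> c + b y \<le> 0"
proof
  obtain y0 where y0: "y0 \<in> B"
    using assms(2) by auto
  have "a x \<le> - b y0" if "x \<in> A" for x
    using assms(3)[OF that y0] by simp
  then have bdd: "bdd_above (a ` A)"
    by (auto intro!: bdd_aboveI2)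
  show "a x \<le> Sup (a ` A)" if "x \<in> A" for x
    using bdd that by (rule cSUP_upper2) auto
  show "Sup (a ` A) + b y \<le> 0" if "y \<in> B" for y
  proof -
    have "Sup (a ` A) \<le> - b y"
      using assms(1,3) that by (intro cSUP_least) (auto simp: le_diff_eq add.commute dest!: assms(3))
    then show ?thesis by simp
  qed
qed

section \<open>Relative interiors\<close>

text \<open>A point of a convex set in a product is relatively interior iff it is so in its slice
  and its base point is so in the projection. Here the projection is \<open>dom F\<close> and the
  slice over \<open>x\<close> is the translate of \<open>K\<close> by \<open>w\<close>.\<close>

lemma mem_rel_interior_cone_epi:
  assumes C: "convex (cone_epi K F)" and "convex K" "K \<noteq> {}"
    and x: "x \<in> rel_interior (dom F)" and F: "F x = Some w" and v: "v - w \<in> rel_interior K"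
  shows "(x, v) \<in> rel_interior (cone_epi K F)"
proof -
  have slice: "{v. (y, v) \<in> cone_epi K F} = (\<lambda>k. k + w') ` K" if "F y = Some w'" for y w'
    using that by (force simp: cone_epi_def image_iff algebra_simps)
  have "{v. (y, v) \<in> cone_epi K F} \<noteq> {} \<longleftrightarrow> y \<in> dom F" for y
    using slice[of y] \<open>K \<noteq> {}\<close> by (cases "F y") (auto simp: cone_epi_def)
  then have dom: "{y. {v. (y, v) \<in> cone_epi K F} \<noteq> {}} = dom F"
    by blast
  have "rel_interior ((+) w ` K) = (+) w ` rel_interior K"
    by (rule rel_interior_translation)
  moreover have "v \<in> (+) w ` rel_interior K"
    using v by (force simp: image_iff algebra_simps)
  moreover have "(\<lambda>k. k + w) ` K = (+) w ` K"
    by (simp add: add.commute)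
  ultimately show ?thesis
    using x unfolding rel_interior_projection[OF C refl] dom slice[OF F] by simp
qed

text \<open>Relative interiors of convex sets commute with products and linear images. This splits
  the qualification on \<open>F\<close> into a point of ri(dom g) and a point of ri K.\<close>

lemma rel_interior_differences:
  fixes A B :: "'n::euclidean_space set"
  assumes "convex A" "convex B"
  shows "rel_interior {x - y |x y. x \<in> A \<and> y \<in> B} =
    {x - y |x y. x \<in> rel_interior A \<and> y \<in> rel_interior B}"
proof -
  have "linear (\<lambda>(x::'n, y). x - y)"
    by (rule linearI) (auto simp: algebra_simps)
  moreover have eq: "{x - y |x y. x \<in> A \<and> y \<in> B} = (\<lambda>(x, y). x - y) ` (A \<times> B)" for A B :: "'n set"
    by auto
  ultimately show ?thesis
    using assms
    by (simp add: rel_interior_convex_linear_image[symmetric] convex_Times rel_interior_Times)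
qed

lemma rel_interior_uminus:
  fixes A :: "'n::euclidean_space set"
  assumes "convex A"
  shows "rel_interior (uminus ` A) = uminus ` rel_interior A"
  using rel_interior_convex_linear_image[OF linear_uminus assms] by simp

section \<open>Epigraphs and conjugates\<close>

text \<open>Heights are real, so that the epigraph is a subset of a Euclidean space and the theory
  of relative interiors applies to it.\<close>

definition epi :: "('a \<Rightarrow> ereal) \<Rightarrow> ('a \<times> real) set"
  where "epi f = {(x, r). f x \<le> ereal r}"

lemma proper_convexD:
  assumes "proper_convex f"
  shows "f x \<noteq> -\<infinity>" "edom f \<noteq> {}" "convex (epi f)"
  using assms by (auto simp: proper_convex_def epi_def)

lemma proper_real:
  assumes "proper_convex f" "x \<in> edom f"
  obtains r where "f x = ereal r"
  using assms by (cases "f x") (auto simp: proper_convex_def edom_def)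

lemma fst_epi:
  assumes "proper_convex f"
  shows "fst ` epi f = edom f"
proof (intro equalityI subsetI)
  fix x assume "x \<in> edom f"
  then obtain r where "f x = ereal r"
    using proper_real assms by blast
  then show "x \<in> fst ` epi f"
    by (force simp: epi_def image_iff)
qed (auto simp: epi_def edom_def)

lemma conjugate_upper: "ereal (y \<bullet> x) - f x \<le> conjugate f y"
  unfolding conjugate_def by (rule SUP_upper) simp

text \<open>Points with value \<infinity> contribute -\<infinity> to the supremum, so real values
  suffice.\<close>

lemma conjugate_leI:
  assumes "\<And>x r. f x = ereal r \<Longrightarrow> y \<bullet> x - r \<le> c" and "\<And>x. f x \<noteq> -\<infinity>"
  shows "conjugate f y \<le> ereal c"
  unfolding conjugate_def
proof (rule SUP_least)
  show "ereal (y \<bullet> x) - f x \<le> ereal c" for x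
    using assms(1)[of x] assms(2)[of x] by (cases "f x") auto
qed

lemma ereal_le_add5:
  assumes "ereal a \<le> A" "ereal b \<le> B" "ereal c \<le> C" "ereal d \<le> D" "ereal e \<le> E"
    and "A + B + C + D + E \<le> 0"
  shows "a + b + c + d + e \<le> 0"
proof -
  have "ereal (a + b + c + d + e) \<le> A + B + C + D + E"
    unfolding plus_ereal.simps(1)[symmetric] by (intro add_mono assms)
  also note assms(6)
  finally show ?thesis by (simp add: zero_ereal_def)
qed

section \<open>Weak duality\<close>

text \<open>Each of the five terms is bounded below at the same \<open>x\<close>. The parts in
  \<open>y\<close>, \<open>z\<close>, \<open>s\<close> and \<open>u\<close> cancel, which leaves
  \<open>v \<bullet> l - (a + b) \<le> 0\<close>, and \<open>v \<bullet> l\<close> is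
  nonnegative.\<close>

lemma weak_duality:
  assumes "proper_convex f" "proper_convex g"
    and v: "v \<in> uminus ` polar L"
    and le: "conjugate g u + conjugate (scalarization u F) y + conjugate (scalarization v G) z
      + support_fun X s + conjugate f (- y - z - s) \<le> 0"
    and x: "x \<in> X" and G: "G x \<in> Some ` uminus ` L"
  shows "0 \<le> f x + comp_top g F x"
\<comment> \<open>In \<open>ereal\<close> a sum with a summand \<infinity> is \<infinity>; this case
  includes the points outside the domain of \<open>F\<close>.\<close>
proof (cases "f x = \<infinity> \<or> comp_top g F x = \<infinity>")
  case True
  then show ?thesis by auto
next
  case False
  then obtain p where p: "F x = Some p" "g p \<noteq> \<infinity>"
    by (auto simp: comp_top_def split: option.splits)
  obtain a where a: "f x = ereal a"
    using False proper_convexD(1)[OF assms(1)] by (cases "f x") auto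
  obtain b where b: "g p = ereal b"
    using p proper_convexD(1)[OF assms(2)] by (cases "g p") auto
  obtain l where l: "G x = Some (- l)" "l \<in> L"
    using G by auto
  have vl: "v \<bullet> l \<ge> 0"
    using v l(2) by (auto simp: polar_def)
  have "(u \<bullet> p - b) + (y \<bullet> x - u \<bullet> p) + (z \<bullet> x - v \<bullet> (- l)) + (x \<bullet> s) + ((- y - z - s) \<bullet> x - a) \<le> 0"
  proof (rule ereal_le_add5[OF _ _ _ _ _ le])
    show "ereal (u \<bullet> p - b) \<le> conjugate g u"
      using conjugate_upper[of u p g] b by simp
    show "ereal (y \<bullet> x - u \<bullet> p) \<le> conjugate (scalarization u F) y"
      using conjugate_upper[of y x "scalarization u F"] p(1) by (simp add: scalarization_def comp_top_def)
    show "ereal (z \<bullet> x - v \<bullet> (- l)) \<le> conjugate (scalarization v G) z"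
      using conjugate_upper[of z x "scalarization v G"] l(1) by (simp add: scalarization_def comp_top_def)
    show "ereal (x \<bullet> s) \<le> support_fun X s"
      unfolding support_fun_def by (rule SUP_upper) (rule x)
    show "ereal ((- y - z - s) \<bullet> x - a) \<le> conjugate f (- y - z - s)"
      using conjugate_upper[of "- y - z - s" x f] a by simp
  qed
  then have "0 \<le> a + b"
    using vl by (simp add: algebra_simps inner_commute)
  then show ?thesis
    using p(1) by (simp add: comp_top_def a b)
qed

section \<open>Existence of multipliers\<close>

lemma multipliers_exist:
  fixes X :: "'a::euclidean_space set" and C\<^sub>1 C\<^sub>2 :: "('a \<times> 'b::euclidean_space) set"
  assumes f: "proper_convex f" and g: "proper_convex g"
    and C: "convex C\<^sub>1" "convex C\<^sub>2" and X: "convex X"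
    and x: "x \<in> rel_interior (edom f)" "x \<in> rel_interior X"
    and y: "y \<in> rel_interior (edom g)" "(x, y) \<in> rel_interior C\<^sub>1"
    and w: "(x, 0) \<in> rel_interior C\<^sub>2"
    and nonneg: "\<And>x y. (x, y) \<in> C\<^sub>1 \<Longrightarrow> (x, 0) \<in> C\<^sub>2 \<Longrightarrow> x \<in> X \<Longrightarrow> 0 \<le> f x + g y"
  obtains q\<^sub>2 q\<^sub>3 q\<^sub>4 u v where
    "\<And>x\<^sub>1 r\<^sub>1 y\<^sub>1 t\<^sub>1 x\<^sub>2 y\<^sub>2 x\<^sub>3 w x\<^sub>4. (x\<^sub>1, r\<^sub>1) \<in> epi f \<Longrightarrow> (y\<^sub>1, t\<^sub>1) \<in> epi g \<Longrightarrow>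
      (x\<^sub>2, y\<^sub>2) \<in> C\<^sub>1 \<Longrightarrow> (x\<^sub>3, w) \<in> C\<^sub>2 \<Longrightarrow> x\<^sub>4 \<in> X \<Longrightarrow>
      q\<^sub>2 \<bullet> (x\<^sub>1 - x\<^sub>2) + q\<^sub>3 \<bullet> (x\<^sub>1 - x\<^sub>3) + q\<^sub>4 \<bullet> (x\<^sub>1 - x\<^sub>4) + u \<bullet> (y\<^sub>1 - y\<^sub>2) + v \<bullet> w \<le> r\<^sub>1 + t\<^sub>1"
proof -
  \<comment> \<open>Every constraint has its own copy of the argument and \<open>A\<close> records
    how far the copies disagree; \<open>B\<close> adds the total height.\<close>
  define A :: "'a \<times> 'b \<times> ('a \<times> 'b) \<times> ('a \<times> 'b) \<times> 'a \<Rightarrow> 'a \<times> 'a \<times> 'a \<times> 'b \<times> 'b"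
    where "A = (\<lambda>(x\<^sub>1, y\<^sub>1, (x\<^sub>2, y\<^sub>2), (x\<^sub>3, w), x\<^sub>4). (x\<^sub>1 - x\<^sub>2, x\<^sub>1 - x\<^sub>3, x\<^sub>1 - x\<^sub>4, y\<^sub>1 - y\<^sub>2, w))"
  define B :: "('a \<times> real) \<times> ('b \<times> real) \<times> ('a \<times> 'b) \<times> ('a \<times> 'b) \<times> 'a
      \<Rightarrow> ('a \<times> 'a \<times> 'a \<times> 'b \<times> 'b) \<times> real"
    where "B = (\<lambda>((x\<^sub>1, r), (y\<^sub>1, t), c, d, x\<^sub>4). (A (x\<^sub>1, y\<^sub>1, c, d, x\<^sub>4), r + t))"
  define S where "S = B ` (epi f \<times> epi g \<times> C\<^sub>1 \<times> C\<^sub>2 \<times> X)"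
  have linA: "linear A"
    unfolding A_def by (rule linearI) (auto simp: algebra_simps)
  have linB: "linear B"
    unfolding B_def A_def by (rule linearI) (auto simp: algebra_simps)
  have convS: "convex S"
    unfolding S_def
    by (intro convex_linear_image linB convex_Times C X proper_convexD(3) f g)
  have convdom: "convex (edom f)" "convex (edom g)"
    unfolding fst_epi[OF f, symmetric] fst_epi[OF g, symmetric]
    by (intro convex_linear_image linear_fst proper_convexD(3) f g)+
  let ?D = "edom f \<times> edom g \<times> C\<^sub>1 \<times> C\<^sub>2 \<times> X"
  \<comment> \<open>Forgetting heights turns epigraphs into domains, so the relative interior of the
    projection is the \<open>A\<close>-image of a product of relative interiors. It contains 0 as
    the image of the point whose copies all agree.\<close>
  have "fst ` S = A ` ?D"
    unfolding S_def fst_epi[OF f, symmetric] fst_epi[OF g, symmetric] B_def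
    by (force simp: image_iff)
  moreover have "rel_interior (A ` ?D) = A ` rel_interior ?D"
    by (intro rel_interior_convex_linear_image[symmetric] linA convex_Times convdom C X)
  moreover have "rel_interior ?D = rel_interior (edom f) \<times> rel_interior (edom g) \<times>
      rel_interior C\<^sub>1 \<times> rel_interior C\<^sub>2 \<times> rel_interior X"
    by (simp add: rel_interior_Times convex_Times convdom C X)
  moreover have "A (x, y, (x, y), (x, 0), x) = 0"
    by (simp add: A_def zero_prod_def)
  ultimately have ri: "0 \<in> rel_interior (fst ` S)"
    using x y w by (force simp: image_iff)
  have pos: "0 \<le> r" if "(0, r) \<in> S" for r
  proof -
    from that obtain x' y' a b where xy: "(x', a) \<in> epi f" "(y', b) \<in> epi g"
      "(x', y') \<in> C\<^sub>1" "(x', 0) \<in> C\<^sub>2" "x' \<in> X" "r = a + b"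
      by (auto simp: S_def B_def A_def zero_prod_def)
    have "0 \<le> f x' + g y'"
      by (intro nonneg xy)
    also have "\<dots> \<le> ereal a + ereal b"
      using xy(1,2) by (intro add_mono) (auto simp: epi_def)
    finally show ?thesis
      using xy(6) by (simp add: zero_ereal_def)
  qed
  obtain q where q: "\<And>e r. (e, r) \<in> S \<Longrightarrow> q \<bullet> e \<le> r"
    using nonvertical_support[OF convS ri pos] by blast
  obtain q\<^sub>2 q\<^sub>3 q\<^sub>4 u v where q_eq: "q = (q\<^sub>2, q\<^sub>3, q\<^sub>4, u, v)"
    by (cases q)
  show thesis
  proof (rule that)
    fix x\<^sub>1 r\<^sub>1 y\<^sub>1 t\<^sub>1 x\<^sub>2 y\<^sub>2 x\<^sub>3 w x\<^sub>4
    assume *: "(x\<^sub>1, r\<^sub>1) \<in> epi f" "(y\<^sub>1, t\<^sub>1) \<in> epi g" "(x\<^sub>2, y\<^sub>2) \<in> C\<^sub>1" "(x\<^sub>3, w) \<in> C\<^sub>2" "x\<^sub>4 \<in> X"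
    have "B ((x\<^sub>1, r\<^sub>1), (y\<^sub>1, t\<^sub>1), (x\<^sub>2, y\<^sub>2), (x\<^sub>3, w), x\<^sub>4) \<in> S"
      unfolding S_def using * by (intro imageI) auto
    then have "((x\<^sub>1 - x\<^sub>2, x\<^sub>1 - x\<^sub>3, x\<^sub>1 - x\<^sub>4, y\<^sub>1 - y\<^sub>2, w), r\<^sub>1 + t\<^sub>1) \<in> S"
      by (simp add: B_def A_def)
    from q[OF this] show
      "q\<^sub>2 \<bullet> (x\<^sub>1 - x\<^sub>2) + q\<^sub>3 \<bullet> (x\<^sub>1 - x\<^sub>3) + q\<^sub>4 \<bullet> (x\<^sub>1 - x\<^sub>4) + u \<bullet> (y\<^sub>1 - y\<^sub>2) + v \<bullet> w \<le> r\<^sub>1 + t\<^sub>1"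
      by (simp add: q_eq)
  qed
qed

section \<open>Sign conditions and decoupling\<close>

lemma bounded_on_cone_imp_nonpos:
  assumes "cone K" "k \<in> K" and "\<And>k. k \<in> K \<Longrightarrow> u \<bullet> k \<le> c"
  shows "u \<bullet> k \<le> 0"
proof (rule ccontr)
  assume "\<not> u \<bullet> k \<le> 0"
  then have pos: "u \<bullet> k > 0" by simp
  \<comment> \<open>This scaling gives \<open>u\<close> the value \<open>\<bar>c\<bar> + 1\<close>
    on the ray through \<open>k\<close>, which exceeds \<open>c\<close>.\<close>
  let ?t = "(\<bar>c\<bar> + 1) / (u \<bullet> k)"
  have "?t *\<^sub>R k \<in> K"
    using assms(1,2) pos by (auto simp: cone_def)
  then have "u \<bullet> (?t *\<^sub>R k) \<le> c"
    by (rule assms(3))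
  with pos show False by simp
qed

text \<open>One family is cut off at a time, the constants already found being carried into the sum
  that remains. Real constants are produced so that the later addition of conjugates involves no
  infinite bounds.\<close>

lemma split_five:
  fixes a :: "'i \<Rightarrow> real" and b :: "'j \<Rightarrow> real" and c :: "'k \<Rightarrow> real" and d :: "'l \<Rightarrow> real"
    and e :: "'m \<Rightarrow> real"
  assumes ne: "A \<noteq> {}" "B \<noteq> {}" "C \<noteq> {}" "D \<noteq> {}" "E \<noteq> {}"
    and le: "\<And>i j k l m. i \<in> A \<Longrightarrow> j \<in> B \<Longrightarrow> k \<in> C \<Longrightarrow> l \<in> D \<Longrightarrow> m \<in> E \<Longrightarrow>
      a i + b j + c k + d l + e m \<le> 0"
  obtains \<alpha> \<beta> \<gamma> \<delta> \<epsilon> where "\<And>i. i \<in> A \<Longrightarrow> a i \<le> \<alpha>" "\<And>j. j \<in> B \<Longrightarrow> b j \<le> \<beta>"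
    "\<And>k. k \<in> C \<Longrightarrow> c k \<le> \<gamma>" "\<And>l. l \<in> D \<Longrightarrow> d l \<le> \<delta>" "\<And>m. m \<in> E \<Longrightarrow> e m \<le> \<epsilon>"
    "\<alpha> + \<beta> + \<gamma> + \<delta> + \<epsilon> \<le> 0"
proof -
  have "a i + (\<lambda>(j, k, l, m). b j + c k + d l + e m) p \<le> 0" if "i \<in> A" "p \<in> B \<times> C \<times> D \<times> E" for i p
    using le that by (auto simp: algebra_simps)
  then obtain \<alpha> where \<alpha>: "\<And>i. i \<in> A \<Longrightarrow> a i \<le> \<alpha>"
    "\<And>p. p \<in> B \<times> C \<times> D \<times> E \<Longrightarrow> \<alpha> + (\<lambda>(j, k, l, m). b j + c k + d l + e m) p \<le> 0"
    by (rule real_cut[of A "B \<times> C \<times> D \<times> E" a "\<lambda>(j, k, l, m). b j + c k + d l + e m", rotated 2])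
      (use ne in auto)
  have "b j + (\<lambda>(k, l, m). \<alpha> + c k + d l + e m) p \<le> 0" if "j \<in> B" "p \<in> C \<times> D \<times> E" for j p
    using \<alpha>(2)[of "(j, p)"] that by (auto simp: algebra_simps)
  then obtain \<beta> where \<beta>: "\<And>j. j \<in> B \<Longrightarrow> b j \<le> \<beta>"
    "\<And>p. p \<in> C \<times> D \<times> E \<Longrightarrow> \<beta> + (\<lambda>(k, l, m). \<alpha> + c k + d l + e m) p \<le> 0"
    by (rule real_cut[of B "C \<times> D \<times> E" b "\<lambda>(k, l, m). \<alpha> + c k + d l + e m", rotated 2])
      (use ne in auto)
  have "c k + (\<lambda>(l, m). \<alpha> + \<beta> + d l + e m) p \<le> 0" if "k \<in> C" "p \<in> D \<times> E" for k p
    using \<beta>(2)[of "(k, p)"] that by (auto simp: algebra_simps)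
  then obtain \<gamma> where \<gamma>: "\<And>k. k \<in> C \<Longrightarrow> c k \<le> \<gamma>"
    "\<And>p. p \<in> D \<times> E \<Longrightarrow> \<gamma> + (\<lambda>(l, m). \<alpha> + \<beta> + d l + e m) p \<le> 0"
    by (rule real_cut[of C "D \<times> E" c "\<lambda>(l, m). \<alpha> + \<beta> + d l + e m", rotated 2])
      (use ne in auto)
  have "d l + (\<lambda>m. \<alpha> + \<beta> + \<gamma> + e m) p \<le> 0" if "l \<in> D" "p \<in> E" for l p
    using \<gamma>(2)[of "(l, p)"] that by (auto simp: algebra_simps)
  then obtain \<delta> where \<delta>: "\<And>l. l \<in> D \<Longrightarrow> d l \<le> \<delta>"
    "\<And>p. p \<in> E \<Longrightarrow> \<delta> + (\<lambda>m. \<alpha> + \<beta> + \<gamma> + e m) p \<le> 0"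
    by (rule real_cut[of D E d "\<lambda>m. \<alpha> + \<beta> + \<gamma> + e m", rotated 2])
      (use ne in auto)
  \<comment> \<open>The last bound is whatever the other four leave, so the constants add up to
    exactly 0.\<close>
  show thesis
    by (rule that[OF \<alpha>(1) \<beta>(1) \<gamma>(1) \<delta>(1), of "- (\<alpha> + \<beta> + \<gamma> + \<delta>)"]) (use \<delta>(2) in force)+
qed

section \<open>The equivalence\<close>

theorem theorem35:
  fixes X :: "'a::euclidean_space set"
    and K L :: "'b::euclidean_space set"
    and F G :: "'a \<Rightarrow> 'b option"
    and f :: "'a \<Rightarrow> ereal"
    and g :: "'b \<Rightarrow> ereal"
  assumes "X \<noteq> {}" and "convex X"
    and "K \<noteq> {}" and "closed K" and "convex K" and "cone K"
    and "L \<noteq> {}" and "closed L" and "convex L" and "cone L"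
    and "cone_convex K F"
    and "cone_convex L G"
    and "proper_convex f"
    and "proper_convex g"
    and "\<forall>(x, y) \<in> cone_epi K F. comp_top g F x \<le> g y"
    and "\<exists>xbar \<in> rel_interior X \<inter> rel_interior (edom f) \<inter> rel_interior (dom F) \<inter> rel_interior (dom G).
           F xbar \<in> Some ` rel_interior {w - k |w k. w \<in> edom g \<and> k \<in> K} \<and>
           G xbar \<in> Some ` rel_interior (uminus ` L)"
  shows "(\<forall>x\<in>X. G x \<in> Some ` uminus ` L \<longrightarrow> f x + comp_top g F x \<ge> 0) \<longleftrightarrow>
    (\<exists>ybar zbar sbar. \<exists>ubar \<in> uminus ` polar K. \<exists>vbar \<in> uminus ` polar L.
       conjugate g ubar + conjugate (scalarization ubar F) ybar +
       conjugate (scalarization vbar G) zbar + support_fun X sbar +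
       conjugate f (- ybar - zbar - sbar) \<le> 0)"
proof
  assume a: "\<forall>x\<in>X. G x \<in> Some ` uminus ` L \<longrightarrow> f x + comp_top g F x \<ge> 0"
  have K0: "0 \<in> K" and L0: "0 \<in> L"
    using assms(3,6,7,10) cone_contains_0 by blast+
  have convF: "convex (cone_epi K F)" and convG: "convex (cone_epi L G)"
    using assms(11,12) by (auto simp: cone_convex_def)
  have convg: "convex (edom g)"
    unfolding fst_epi[OF assms(14), symmetric]
    by (intro convex_linear_image linear_fst proper_convexD(3) assms(14))
  obtain x p w where x: "x \<in> rel_interior X" "x \<in> rel_interior (edom f)"
      "x \<in> rel_interior (dom F)" "x \<in> rel_interior (dom G)"
    and p: "F x = Some p" "p \<in> rel_interior {w - k |w k. w \<in> edom g \<and> k \<in> K}"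
    and w: "G x = Some w" "w \<in> rel_interior (uminus ` L)"
    using assms(16) by auto
  \<comment> \<open>Since \<open>y - p = k\<close> is relatively interior to \<open>K\<close>, the
    point \<open>y\<close> lies above \<open>F x\<close> in the way required for
    \<open>(x, y)\<close> to be relatively interior to the \<open>K\<close>-epigraph.\<close>
  obtain y k where y: "y \<in> rel_interior (edom g)" "k \<in> rel_interior K" "p = y - k"
    using p(2) by (auto simp: rel_interior_differences[OF convg assms(5)])
  have xy: "(x, y) \<in> rel_interior (cone_epi K F)"
    by (rule mem_rel_interior_cone_epi[OF convF assms(5,3) x(3) p(1)]) (use y in simp)
  have x0: "(x, 0) \<in> rel_interior (cone_epi L G)"
    by (rule mem_rel_interior_cone_epi[OF convG assms(9,7) x(4) w(1)])
      (use w(2) in \<open>auto simp: rel_interior_uminus[OF assms(9)]\<close>)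
  \<comment> \<open>Membership of \<open>(x, 0)\<close> in the \<open>L\<close>-epigraph is
    feasibility of \<open>x\<close>; monotonicity of \<open>g\<close> along the
    \<open>K\<close>-epigraph carries (a) from the value of \<open>F\<close> to every
    \<open>y\<close> above it.\<close>
  have nonneg: "0 \<le> f x + g y"
    if "(x, y) \<in> cone_epi K F" "(x, 0) \<in> cone_epi L G" "x \<in> X" for x y
  proof -
    have "G x \<in> Some ` uminus ` L"
      using that(2) by (force simp: cone_epi_def image_iff)
    then have "0 \<le> f x + comp_top g F x"
      using a that(3) by blast
    also have "\<dots> \<le> f x + g y"
      using assms(15) that(1) by (intro add_left_mono) auto
    finally show ?thesis .
  qed
  obtain q\<^sub>2 q\<^sub>3 q\<^sub>4 u v where q:
    "\<And>x\<^sub>1 r\<^sub>1 y\<^sub>1 t\<^sub>1 x\<^sub>2 y\<^sub>2 x\<^sub>3 w x\<^sub>4. (x\<^sub>1, r\<^sub>1) \<in> epi f \<Longrightarrow> (y\<^sub>1, t\<^sub>1) \<in> epi g \<Longrightarrow>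
      (x\<^sub>2, y\<^sub>2) \<in> cone_epi K F \<Longrightarrow> (x\<^sub>3, w) \<in> cone_epi L G \<Longrightarrow> x\<^sub>4 \<in> X \<Longrightarrow>
      q\<^sub>2 \<bullet> (x\<^sub>1 - x\<^sub>2) + q\<^sub>3 \<bullet> (x\<^sub>1 - x\<^sub>3) + q\<^sub>4 \<bullet> (x\<^sub>1 - x\<^sub>4) + u \<bullet> (y\<^sub>1 - y\<^sub>2) + v \<bullet> w \<le> r\<^sub>1 + t\<^sub>1"
    using multipliers_exist[OF assms(13,14) convF convG assms(2) x(2,1) y(1) xy x0 nonneg] by metis
  have ne: "epi g \<noteq> {}" "cone_epi K F \<noteq> {}" "cone_epi L G \<noteq> {}" "epi f \<noteq> {}"
    using proper_convexD(2)[OF assms(13)] proper_convexD(2)[OF assms(14)] xy x0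
      fst_epi[OF assms(13)] fst_epi[OF assms(14)] rel_interior_subset by blast+
  \<comment> \<open>Regrouped by variables, the copy \<open>x\<^sub>1\<close> collects all three
    slopes, which yields the argument of the conjugate of \<open>f\<close>. The term in
    \<open>v\<close> enters with a plus sign, so the multiplier of \<open>G\<close> will be
    \<open>- v\<close>.\<close>
  obtain \<alpha> \<beta> \<gamma> \<delta> \<epsilon> where
      \<alpha>: "\<And>i. i \<in> epi g \<Longrightarrow> u \<bullet> fst i - snd i \<le> \<alpha>"
    and \<beta>: "\<And>i. i \<in> cone_epi K F \<Longrightarrow> - q\<^sub>2 \<bullet> fst i - u \<bullet> snd i \<le> \<beta>"
    and \<gamma>: "\<And>i. i \<in> cone_epi L G \<Longrightarrow> - q\<^sub>3 \<bullet> fst i + v \<bullet> snd i \<le> \<gamma>"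
    and \<delta>: "\<And>i. i \<in> X \<Longrightarrow> - q\<^sub>4 \<bullet> i \<le> \<delta>"
    and \<epsilon>: "\<And>i. i \<in> epi f \<Longrightarrow> (q\<^sub>2 + q\<^sub>3 + q\<^sub>4) \<bullet> fst i - snd i \<le> \<epsilon>"
    and sum: "\<alpha> + \<beta> + \<gamma> + \<delta> + \<epsilon> \<le> 0"
  proof (rule split_five[of "epi g" "cone_epi K F" "cone_epi L G" X "epi f"
        "\<lambda>i. u \<bullet> fst i - snd i" "\<lambda>i. - q\<^sub>2 \<bullet> fst i - u \<bullet> snd i" "\<lambda>i. - q\<^sub>3 \<bullet> fst i + v \<bullet> snd i"
        "\<lambda>i. - q\<^sub>4 \<bullet> i" "\<lambda>i. (q\<^sub>2 + q\<^sub>3 + q\<^sub>4) \<bullet> fst i - snd i"])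
    fix i j k l m
    assume "i \<in> epi g" "j \<in> cone_epi K F" "k \<in> cone_epi L G" "l \<in> X" "m \<in> epi f"
    then show "u \<bullet> fst i - snd i + (- q\<^sub>2 \<bullet> fst j - u \<bullet> snd j) + (- q\<^sub>3 \<bullet> fst k + v \<bullet> snd k)
        + - q\<^sub>4 \<bullet> l + ((q\<^sub>2 + q\<^sub>3 + q\<^sub>4) \<bullet> fst m - snd m) \<le> 0"
      using q[of "fst m" "snd m" "fst i" "snd i" "fst j" "snd j" "fst k" "snd k" l]
      by (simp add: algebra_simps)
  qed (use ne assms(1) in blast)+
  \<comment> \<open>Over the fixed point \<open>x\<close> the slice of the epigraph is
    \<open>p + K\<close>, and \<beta> bounds \<open>- u\<close> on this translated cone.\<close>
  have u: "- u \<in> polar K"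
    unfolding polar_def
  proof safe
    fix k assume "k \<in> K"
    show "- u \<bullet> k \<le> 0"
    proof (rule bounded_on_cone_imp_nonpos[OF assms(6) \<open>k \<in> K\<close>])
      fix k assume "k \<in> K"
      then have "(x, p + k) \<in> cone_epi K F"
        by (simp add: cone_epi_def p)
      from \<beta>[OF this] show "- u \<bullet> k \<le> \<beta> + q\<^sub>2 \<bullet> x + u \<bullet> p"
        by (simp add: algebra_simps)
    qed
  qed
  have v: "v \<in> polar L"
    unfolding polar_def
  proof safe
    fix l assume "l \<in> L"
    show "v \<bullet> l \<le> 0"
    proof (rule bounded_on_cone_imp_nonpos[OF assms(10) \<open>l \<in> L\<close>])
      fix l assume "l \<in> L"
      then have "(x, w + l) \<in> cone_epi L G"
        by (simp add: cone_epi_def w)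
      from \<gamma>[OF this] show "v \<bullet> l \<le> \<gamma> + q\<^sub>3 \<bullet> x - v \<bullet> w"
        by (simp add: algebra_simps)
    qed
  qed
  \<comment> \<open>The witnesses are \<open>- q\<^sub>2\<close>, \<open>- q\<^sub>3\<close>,
    \<open>- q\<^sub>4\<close> for ybar, zbar, sbar; the double negations keep the shape of
    (b).\<close>
  have "conjugate g u + conjugate (scalarization u F) (- q\<^sub>2) +
      conjugate (scalarization (- v) G) (- q\<^sub>3) + support_fun X (- q\<^sub>4) +
      conjugate f (- (- q\<^sub>2) - (- q\<^sub>3) - (- q\<^sub>4)) \<le>
      ereal \<alpha> + ereal \<beta> + ereal \<gamma> + ereal \<delta> + ereal \<epsilon>"
  proof (intro add_mono)
    show "conjugate g u \<le> ereal \<alpha>"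
    proof (rule conjugate_leI)
      fix y r assume "g y = ereal r"
      then show "u \<bullet> y - r \<le> \<alpha>"
        using \<alpha>[of "(y, r)"] by (simp add: epi_def)
    qed (rule proper_convexD(1)[OF assms(14)])
    show "conjugate (scalarization u F) (- q\<^sub>2) \<le> ereal \<beta>"
    proof (rule conjugate_leI)
      fix x r assume "scalarization u F x = ereal r"
      then obtain p where "F x = Some p" "r = u \<bullet> p"
        by (auto simp: scalarization_def comp_top_def split: option.splits)
      \<comment> \<open>As 0 is in \<open>K\<close>, the graph of \<open>F\<close> lies in its
        epigraph, so \<beta> applies to it.\<close>
      then show "- q\<^sub>2 \<bullet> x - r \<le> \<beta>"
        using \<beta>[of "(x, p)"] K0 by (simp add: cone_epi_def)
    qed (auto simp: scalarization_def comp_top_def split: option.splits)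
    show "conjugate (scalarization (- v) G) (- q\<^sub>3) \<le> ereal \<gamma>"
    proof (rule conjugate_leI)
      fix x r assume "scalarization (- v) G x = ereal r"
      then obtain w where "G x = Some w" "r = - v \<bullet> w"
        by (auto simp: scalarization_def comp_top_def split: option.splits)
      then show "- q\<^sub>3 \<bullet> x - r \<le> \<gamma>"
        using \<gamma>[of "(x, w)"] L0 by (simp add: cone_epi_def)
    qed (auto simp: scalarization_def comp_top_def split: option.splits)
    show "support_fun X (- q\<^sub>4) \<le> ereal \<delta>"
      unfolding support_fun_def using \<delta> by (intro SUP_least) (simp add: inner_commute)
    show "conjugate f (- (- q\<^sub>2) - (- q\<^sub>3) - (- q\<^sub>4)) \<le> ereal \<epsilon>"
    proof (rule conjugate_leI)
      fix x r assume "f x = ereal r"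
      then show "(- (- q\<^sub>2) - (- q\<^sub>3) - (- q\<^sub>4)) \<bullet> x - r \<le> \<epsilon>"
        using \<epsilon>[of "(x, r)"] by (simp add: epi_def)
    qed (rule proper_convexD(1)[OF assms(13)])
  qed
  also have "\<dots> \<le> 0"
    using sum by (simp add: zero_ereal_def)
  finally have "conjugate g u + conjugate (scalarization u F) (- q\<^sub>2) +
      conjugate (scalarization (- v) G) (- q\<^sub>3) + support_fun X (- q\<^sub>4) +
      conjugate f (- (- q\<^sub>2) - (- q\<^sub>3) - (- q\<^sub>4)) \<le> 0" .
  moreover have "u \<in> uminus ` polar K" "- v \<in> uminus ` polar L"
    using u v by (auto intro: image_eqI[of u uminus "- u"])
  ultimately show "\<exists>ybar zbar sbar. \<exists>ubar \<in> uminus ` polar K. \<exists>vbar \<in> uminus ` polar L.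
       conjugate g ubar + conjugate (scalarization ubar F) ybar +
       conjugate (scalarization vbar G) zbar + support_fun X sbar +
       conjugate f (- ybar - zbar - sbar) \<le> 0"
    by blast
next
  assume "\<exists>ybar zbar sbar. \<exists>ubar \<in> uminus ` polar K. \<exists>vbar \<in> uminus ` polar L.
       conjugate g ubar + conjugate (scalarization ubar F) ybar +
       conjugate (scalarization vbar G) zbar + support_fun X sbar +
       conjugate f (- ybar - zbar - sbar) \<le> 0"
  then show "\<forall>x\<in>X. G x \<in> Some ` uminus ` L \<longrightarrow> f x + comp_top g F x \<ge> 0"
    using weak_duality[OF assms(13,14)] by blast
qed

end
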